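(* Let $(L,[\cdot,\cdot]_L,\alpha)$ and $(\Gamma,[\cdot,\cdot]_\Gamma,\beta)$ be two hom-Lie superalgebras over a field $\mathbf K$. Then $(L\oplus\Gamma,[\cdot,\cdot]_{L\oplus\Gamma},\alpha+\beta)$ is a hom-Lie superalgebra, where the bilinear bracket is given by $$[u_1+v_1,u_2+v_2]_{L\oplus\Gamma}=[u_1,u_2]_L+[v_1,v_2]_\Gamma,\qquad u_1,u_2\in L,\ v_1,v_2\in\Gamma,$$ and the linear map $\alpha+\beta:L\oplus\Gamma\to L\oplus\Gamma$ is given by $(\alpha+\beta)(u+v)=\alpha(u)+\beta(v)$ for $u\in L$, $v\in\Gamma$.
   Context: A hom-Lie superalgebra is a triple $(L,[\cdot,\cdot]_L,\alpha)$ with $L=L_{\bar 0}\oplus L_{\bar 1}$ a $\mathbb Z_2$-graded vector space over a field ($|x|$ is the degree of homogeneous $x$), $[\cdot,\cdot]_L:L\times L\to L$ an even bilinear map and $\alpha:L\to L$ an even linear map such that for all homogeneous $x,y,z$: $[x,y]_L=-(-1)^{|x||y|}[y,x]_L$ and $$(-1)^{|x||z|}[\alpha(x),[y,z]_L]_L+(-1)^{|y||x|}[\alpha(y),[z,x]_L]_L+(-1)^{|z||y|}[\alpha(z),[x,y]_L]_L=0.$$ $L\oplus\Gamma$ is graded by $(L\oplus\Gamma)_\theta=L_\theta\oplus\Gamma_\theta$, $\theta\in\mathbb Z_2$. *)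

theory Defs
  imports "HOL-Analysis.Product_Vector" "HOL-Library.Z2"
begin

text \<open>The grading group $Z_2$ is the type \<^typ>\<open>bit\<close>, so that addition of degrees is addition
  modulo 2. A homogeneous element of degree \<open>a\<close> is an element of \<open>grade a\<close>; zero is homogeneous
  of both degrees.\<close>

locale super_vector_space = vector_space scale
  for scale :: "'k::field \<Rightarrow> 'v::ab_group_add \<Rightarrow> 'v" +
  fixes grade :: "bit \<Rightarrow> 'v set"
  assumes subspace_grade: "subspace (grade a)"
    and grade_Int: "grade 0 \<inter> grade 1 = {0}"
    and grade_sum: "\<exists>x\<^sub>0 \<in> grade 0. \<exists>x\<^sub>1 \<in> grade 1. x = x\<^sub>0 + x\<^sub>1"

text \<open>The sign $(-1)^{|x||y|}$ for \<open>|x| = a\<close> and \<open>|y| = b\<close>.\<close>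

definition koszul_sign :: "bit \<Rightarrow> bit \<Rightarrow> 'k::field"
  where "koszul_sign a b = (- 1) ^ (if a * b = 1 then 1 else 0)"

locale hom_lie_superalgebra = super_vector_space scale grade
  for scale :: "'k::field \<Rightarrow> 'v::ab_group_add \<Rightarrow> 'v"
    and grade :: "bit \<Rightarrow> 'v set" +
  fixes bracket :: "'v \<Rightarrow> 'v \<Rightarrow> 'v"
    and twist :: "'v \<Rightarrow> 'v"
  assumes linear_bracket_left: "Vector_Spaces.linear scale scale (\<lambda>x. bracket x y)"
    and linear_bracket_right: "Vector_Spaces.linear scale scale (\<lambda>y. bracket x y)"
    and even_bracket: "x \<in> grade a \<Longrightarrow> y \<in> grade b \<Longrightarrow> bracket x y \<in> grade (a + b)"
    and linear_twist: "Vector_Spaces.linear scale scale twist"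
    and even_twist: "x \<in> grade a \<Longrightarrow> twist x \<in> grade a"
    and super_skew_symmetry:
      "x \<in> grade a \<Longrightarrow> y \<in> grade b \<Longrightarrow>
        bracket x y = - scale (koszul_sign a b) (bracket y x)"
    and hom_super_Jacobi:
      "x \<in> grade a \<Longrightarrow> y \<in> grade b \<Longrightarrow> z \<in> grade c \<Longrightarrow>
        scale (koszul_sign a c) (bracket (twist x) (bracket y z)) +
        scale (koszul_sign b a) (bracket (twist y) (bracket z x)) +
        scale (koszul_sign c b) (bracket (twist z) (bracket x y)) = 0"

text \<open>The direct sum of \<open>L\<close> and \<open>\<Gamma>\<close> is the product type, where \<open>u + v\<close> is the pair \<open>(u, v)\<close>;
  its scalar multiplication is \<^const>\<open>module_prod.scale\<close>.\<close>

definition sum_grade :: "(bit \<Rightarrow> 'l set) \<Rightarrow> (bit \<Rightarrow> 'g set) \<Rightarrow> bit \<Rightarrow> ('l \<times> 'g) set"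
  where "sum_grade gradeL gradeG \<theta> = gradeL \<theta> \<times> gradeG \<theta>"

definition sum_bracket ::
    "('l \<Rightarrow> 'l \<Rightarrow> 'l) \<Rightarrow> ('g \<Rightarrow> 'g \<Rightarrow> 'g) \<Rightarrow> 'l \<times> 'g \<Rightarrow> 'l \<times> 'g \<Rightarrow> 'l \<times> 'g"
  where "sum_bracket bracketL bracketG =
    (\<lambda>(u\<^sub>1, v\<^sub>1) (u\<^sub>2, v\<^sub>2). (bracketL u\<^sub>1 u\<^sub>2, bracketG v\<^sub>1 v\<^sub>2))"

definition sum_twist :: "('l \<Rightarrow> 'l) \<Rightarrow> ('g \<Rightarrow> 'g) \<Rightarrow> 'l \<times> 'g \<Rightarrow> 'l \<times> 'g"
  where "sum_twist \<alpha> \<beta> = (\<lambda>(u, v). (\<alpha> u, \<beta> v))"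

end

theory Submission
  imports Defs
begin

text \<open>A pair \<open>(u, v)\<close> is homogeneous of degree \<open>\<theta>\<close> exactly when both \<open>u\<close> and \<open>v\<close>
  are, so on homogeneous pairs the Koszul signs are the same in both components, and bracket,
  twist and scalar multiplication all act componentwise. Hence each axiom for the direct sum
  splits into the corresponding axioms for the two summands. The axioms that do not mention
  homogeneous elements are treated separately: bilinearity of the bracket and linearity of the
  twist come from \<open>linear_componentwise\<close>, the grading from \<open>super_vector_space_sum\<close>.\<close>

lemma linear_componentwise:
  assumes f: "Vector_Spaces.linear scaleL scaleL f" and g: "Vector_Spaces.linear scaleG scaleG g"
  shows "Vector_Spaces.linear (module_prod.scale scaleL scaleG)
    (module_prod.scale scaleL scaleG) (\<lambda>p. (f (fst p), g (snd p)))"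
proof -
  interpret f: Vector_Spaces.linear scaleL scaleL f by fact
  interpret g: Vector_Spaces.linear scaleG scaleG g by fact
  interpret vector_space_prod scaleL scaleG by unfold_locales
  show ?thesis
    by (auto simp: Vector_Spaces.linear_iff p.vector_space_axioms scale_prod f.add g.add f.scale g.scale)
qed

text \<open>The homogeneous parts of a pair are built from those of its components, so the even and odd
  subspaces stay complementary in the product.\<close>

lemma super_vector_space_sum:
  assumes "super_vector_space scaleL gradeL" "super_vector_space scaleG gradeG"
  shows "super_vector_space (module_prod.scale scaleL scaleG) (sum_grade gradeL gradeG)"
proof -
  interpret L: super_vector_space scaleL gradeL by fact
  interpret G: super_vector_space scaleG gradeG by fact
  interpret P: vector_space_prod scaleL scaleG by unfold_locales
  show ?thesis
  proof
    fix \<theta>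
    show "P.p.subspace (sum_grade gradeL gradeG \<theta>)"
      unfolding sum_grade_def by (intro P.subspace_Times L.subspace_grade G.subspace_grade)
  next
    show "sum_grade gradeL gradeG 0 \<inter> sum_grade gradeL gradeG 1 = {0}"
      using L.grade_Int G.grade_Int
      by (simp add: sum_grade_def Times_Int_Times zero_prod_def)
  next
    fix p :: "'b \<times> 'c"
    obtain u\<^sub>0 u\<^sub>1 where u: "u\<^sub>0 \<in> gradeL 0" "u\<^sub>1 \<in> gradeL 1" "fst p = u\<^sub>0 + u\<^sub>1"
      using L.grade_sum by blast
    obtain v\<^sub>0 v\<^sub>1 where v: "v\<^sub>0 \<in> gradeG 0" "v\<^sub>1 \<in> gradeG 1" "snd p = v\<^sub>0 + v\<^sub>1"
      using G.grade_sum by blast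
    have "p = (u\<^sub>0, v\<^sub>0) + (u\<^sub>1, v\<^sub>1)"
      using u v by (simp add: prod_eq_iff)
    then show "\<exists>x\<^sub>0\<in>sum_grade gradeL gradeG 0. \<exists>x\<^sub>1\<in>sum_grade gradeL gradeG 1. p = x\<^sub>0 + x\<^sub>1"
      using u v unfolding sum_grade_def by blast
  qed
qed

theorem proposition2p2:
  fixes scaleL :: "'k::field \<Rightarrow> 'l::ab_group_add \<Rightarrow> 'l"
    and scaleG :: "'k \<Rightarrow> 'g::ab_group_add \<Rightarrow> 'g"
    and gradeL :: "bit \<Rightarrow> 'l set" and gradeG :: "bit \<Rightarrow> 'g set"
    and bracketL :: "'l \<Rightarrow> 'l \<Rightarrow> 'l" and bracketG :: "'g \<Rightarrow> 'g \<Rightarrow> 'g"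
    and \<alpha> :: "'l \<Rightarrow> 'l" and \<beta> :: "'g \<Rightarrow> 'g"
  assumes "hom_lie_superalgebra scaleL gradeL bracketL \<alpha>"
    and "hom_lie_superalgebra scaleG gradeG bracketG \<beta>"
  shows "hom_lie_superalgebra (module_prod.scale scaleL scaleG) (sum_grade gradeL gradeG)
    (sum_bracket bracketL bracketG) (sum_twist \<alpha> \<beta>)"
proof -
  interpret L: hom_lie_superalgebra scaleL gradeL bracketL \<alpha> by fact
  interpret G: hom_lie_superalgebra scaleG gradeG bracketG \<beta> by fact
  interpret P: vector_space_prod scaleL scaleG by unfold_locales
  let ?s = "module_prod.scale scaleL scaleG"
  show ?thesis
  proof (intro hom_lie_superalgebra.intro hom_lie_superalgebra_axioms.intro)
    show "super_vector_space ?s (sum_grade gradeL gradeG)"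
      by (intro super_vector_space_sum L.super_vector_space_axioms G.super_vector_space_axioms)
  next
    fix p
    show "Vector_Spaces.linear ?s ?s (\<lambda>q. sum_bracket bracketL bracketG q p)"
      using linear_componentwise[OF L.linear_bracket_left[of "fst p"]
          G.linear_bracket_left[of "snd p"]]
      by (simp add: sum_bracket_def case_prod_unfold)
    show "Vector_Spaces.linear ?s ?s (sum_bracket bracketL bracketG p)"
      using linear_componentwise[OF L.linear_bracket_right[of "fst p"]
          G.linear_bracket_right[of "snd p"]]
      by (simp add: sum_bracket_def case_prod_unfold)
  next
    show "Vector_Spaces.linear ?s ?s (sum_twist \<alpha> \<beta>)"
      using linear_componentwise[OF L.linear_twist G.linear_twist]
      by (simp add: sum_twist_def case_prod_unfold)
  next
    fix p q a b
    assume "p \<in> sum_grade gradeL gradeG a" "q \<in> sum_grade gradeL gradeG b"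
    \<comment> \<open>Full simplification would evaluate the degree \<open>a + b\<close> in \<open>bit\<close> by cases, after which evenness
      of the brackets no longer matches.\<close>
    then show "sum_bracket bracketL bracketG p q \<in> sum_grade gradeL gradeG (a + b)"
      by (simp only: sum_grade_def sum_bracket_def mem_Times_iff case_prod_unfold fst_conv snd_conv
          L.even_bracket G.even_bracket simp_thms)
  next
    fix p a
    assume "p \<in> sum_grade gradeL gradeG a"
    then show "sum_twist \<alpha> \<beta> p \<in> sum_grade gradeL gradeG a"
      by (auto simp: sum_grade_def sum_twist_def L.even_twist G.even_twist)
  next
    fix p q a b
    assume "p \<in> sum_grade gradeL gradeG a" "q \<in> sum_grade gradeL gradeG b"
    then show "sum_bracket bracketL bracketG p q
        = - ?s (koszul_sign a b) (sum_bracket bracketL bracketG q p)"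
      by (auto simp: sum_grade_def sum_bracket_def P.scale_prod
          intro: L.super_skew_symmetry G.super_skew_symmetry)
  next
    fix p q r a b c
    assume "p \<in> sum_grade gradeL gradeG a" "q \<in> sum_grade gradeL gradeG b"
      "r \<in> sum_grade gradeL gradeG c"
    then show "?s (koszul_sign a c) (sum_bracket bracketL bracketG (sum_twist \<alpha> \<beta> p)
          (sum_bracket bracketL bracketG q r)) +
        ?s (koszul_sign b a) (sum_bracket bracketL bracketG (sum_twist \<alpha> \<beta> q)
          (sum_bracket bracketL bracketG r p)) +
        ?s (koszul_sign c b) (sum_bracket bracketL bracketG (sum_twist \<alpha> \<beta> r)
          (sum_bracket bracketL bracketG p q)) = 0"
      by (auto simp: sum_grade_def sum_bracket_def sum_twist_def P.scale_prod
          zero_prod_def L.hom_super_Jacobi G.hom_super_Jacobi)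
  qed
qed

end
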